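(* Let $B$ be a semi-Boolean restriction semigroup with projections $P$. Then the ultrafilter semicategory $\mathcal U(B)$ is a groupoid if and only if every element of $B$ is a finite join (in the poset $B$) of elements of $B^\times$, the set of invertible elements of $B$.
   Context: **Restriction semigroups.** Let $B$ be a semigroup with a distinguished commutative subsemigroup $P$ of idempotents ("projections"). Write $a\leq b$ iff $a=bp$ for some $p\in P$; $\mathsf s(a)=\min\{p\in P:ap=a\}$ and $\mathsf r(a)=\min\{p\in P:pa=a\}$ when these minima exist. $B$ is a restriction semigroup relative to $P$ if every element has a source projection $\mathsf s(a)$ (then $\leq$ is a partial order), $\mathsf s(ab)=\mathsf s(\mathsf s(a)b)$ for all $a,b\in B$, and $pb\leq b$ for all $p\in P$, $b\in B$. Elements $a,b\in B$ are inverses of each other if $\mathsf r(a)$ and $\mathsf r(b)$ exist, $\mathsf r(a)=ab=\mathsf s(b)$ and $\mathsf r(b)=ba=\mathsf s(a)$. $B^\times$ is the set of $a\in B$ having an inverse. **Semi-Boolean.** A poset is a semi-Boolean algebra if every pair of elements has a meet and every principal ideal $\{c:c\leq b\}$ is a Boolean algebra. A semi-Boolean restriction semigroup is a restriction semigroup $B$ with an element $0\in P$ satisfying $0b=0$ for all $b\in B$ (then $0$ is also a right zero and the minimum of $B$), such that $(B,\leq)$ is a semi-Boolean algebra and $(a\vee b)c=ac\vee bc$ for all $a,b,c\in B$ with $a,b$ having an upper bound. **Ultrafilter semicategory.** A filter in the poset $B$ is a non-empty up-set $F$ such that any $a,b\in F$ have a common lower bound in $F$; it is proper if $F\neq B$;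 an ultrafilter is a maximal proper filter. $\mathcal U(B)$ is the set of ultrafilters with partial product $V\cdot W=\{c\in B:\exists v\in V,w\in W,\ vw\leq c\}$, defined precisely when $0\notin VW=\{vw:v\in V,w\in W\}$. It is a semicategory in the following sense. **Semicategories and groupoids.** A semigroupoid is a set $S$ with a product defined on some pairs $S^2\subseteq S\times S$ such that $(ab)c$ is defined iff $a(bc)$ is defined, in which case they are equal. Its units are $S^0=\{u\in S:\forall a\in S\ [(u,a)\in S^2\Rightarrow ua=a]\text{ and }[(a,u)\in S^2\Rightarrow au=a]\}$. The source unit $\mathsf s(a)$ is the (unique, if it exists) $u\in S^0$ with $(a,u)\in S^2$; the range unit $\mathsf r(a)$ is the (unique, if it exists) $u\in S^0$ with $(u,a)\in S^2$. $S$ is a semicategory if every $a\in S$ has a source unit and $S^2=\{(a,b):\mathsf r(b)\text{ exists and }\mathsf s(a)=\mathsf r(b)\}$. Elements $a,b$ of a semicategory are inverses if $\mathsf r(a)=ab=\mathsf s(b)$ and $\mathsf r(b)=ba=\mathsf s(a)$. A groupoid is a semicategory in which every element has an inverse. *)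

theory Defs
  imports "HOL-Algebra.Lattice"
begin

section \<open>Semi-Boolean algebras and ultrafilters in posets\<close>

locale boolean_lattice = bounded_lattice L for L (structure) +
  assumes distrib: "\<lbrakk>x \<in> carrier L; y \<in> carrier L; w \<in> carrier L\<rbrakk>
      \<Longrightarrow> x \<sqinter> (y \<squnion> w) = (x \<sqinter> y) \<squnion> (x \<sqinter> w)"
    and complemented: "x \<in> carrier L
      \<Longrightarrow> \<exists>y\<in>carrier L. x \<sqinter> y = \<bottom> \<and> x \<squnion> y = \<top>"

definition principal_ideal :: "('a, 'b) gorder_scheme \<Rightarrow> 'a \<Rightarrow> ('a, 'b) gorder_scheme" where
  "principal_ideal L b = L\<lparr>carrier := {c \<in> carrier L. c \<sqsubseteq>\<^bsub>L\<^esub> b}\<rparr>"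

locale semi_boolean_algebra = lower_semilattice L for L (structure) +
  assumes ideal_boolean: "b \<in> carrier L \<Longrightarrow> boolean_lattice (principal_ideal L b)"

definition order_filter :: "('a, 'b) gorder_scheme \<Rightarrow> 'a set \<Rightarrow> bool" where
  "order_filter L F \<longleftrightarrow> F \<subseteq> carrier L \<and> F \<noteq> {} \<and>
     (\<forall>a\<in>F. \<forall>b\<in>carrier L. a \<sqsubseteq>\<^bsub>L\<^esub> b \<longrightarrow> b \<in> F) \<and>
     (\<forall>a\<in>F. \<forall>b\<in>F. \<exists>c\<in>F. c \<sqsubseteq>\<^bsub>L\<^esub> a \<and> c \<sqsubseteq>\<^bsub>L\<^esub> b)"

definition proper_filter :: "('a, 'b) gorder_scheme \<Rightarrow> 'a set \<Rightarrow> bool" where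
  "proper_filter L F \<longleftrightarrow> order_filter L F \<and> F \<noteq> carrier L"

definition ultrafilter :: "('a, 'b) gorder_scheme \<Rightarrow> 'a set \<Rightarrow> bool" where
  "ultrafilter L F \<longleftrightarrow> proper_filter L F \<and> (\<forall>G. proper_filter L G \<longrightarrow> F \<subseteq> G \<longrightarrow> G = F)"


section \<open>Semi-Boolean restriction semigroups\<close>

definition proj_order :: "'a::semigroup_mult set \<Rightarrow> 'a gorder" where
  "proj_order P = \<lparr>carrier = UNIV, eq = (=), le = (\<lambda>a b. \<exists>p\<in>P. a = b * p)\<rparr>"

text \<open>Source and range projections need not exist, so they are given as relations;
  on projections the order of the whole semigroup agrees with the usual one
  (\<open>p \<sqsubseteq> q\<close> iff \<open>p = q * p\<close>), whence they are unique.\<close>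

definition is_source_proj :: "'a::semigroup_mult set \<Rightarrow> 'a \<Rightarrow> 'a \<Rightarrow> bool" where
  "is_source_proj P a p \<longleftrightarrow> least (proj_order P) p {q \<in> P. a * q = a}"

definition is_range_proj :: "'a::semigroup_mult set \<Rightarrow> 'a \<Rightarrow> 'a \<Rightarrow> bool" where
  "is_range_proj P a p \<longleftrightarrow> least (proj_order P) p {q \<in> P. q * a = a}"

definition source_proj :: "'a::semigroup_mult set \<Rightarrow> 'a \<Rightarrow> 'a" where
  "source_proj P a = (THE p. is_source_proj P a p)"

locale projections =
  fixes P :: "'a::semigroup_mult set"
  assumes proj_closed: "\<lbrakk>p \<in> P; q \<in> P\<rbrakk> \<Longrightarrow> p * q \<in> P"
    and proj_commute: "\<lbrakk>p \<in> P; q \<in> P\<rbrakk> \<Longrightarrow> p * q = q * p"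
    and proj_idem: "p \<in> P \<Longrightarrow> p * p = p"
begin

lemma proj_order_antisym:
  assumes "a \<sqsubseteq>\<^bsub>proj_order P\<^esub> b" "b \<sqsubseteq>\<^bsub>proj_order P\<^esub> a"
  shows "a = b"
proof -
  obtain p q where p: "p \<in> P" "a = b * p" and q: "q \<in> P" "b = a * q"
    using assms by (auto simp: proj_order_def)
  have "a * p = a" using p proj_idem by (metis mult.assoc)
  have "a = a * q * p" using p q by simp
  also have "\<dots> = a * p * q" using p q proj_commute by (metis mult.assoc)
  also have "\<dots> = b" using \<open>a * p = a\<close> q by simp
  finally show ?thesis .
qed

lemma source_proj_unique: "\<lbrakk>is_source_proj P a p; is_source_proj P a q\<rbrakk> \<Longrightarrow> p = q"
  unfolding is_source_proj_def least_def by (intro proj_order_antisym) auto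

lemma range_proj_unique: "\<lbrakk>is_range_proj P a p; is_range_proj P a q\<rbrakk> \<Longrightarrow> p = q"
  unfolding is_range_proj_def least_def by (intro proj_order_antisym) auto

end

locale restriction_semigroup = projections +
  assumes source_exists: "\<exists>p. is_source_proj P a p"
    and source_mult: "source_proj P (a * b) = source_proj P (source_proj P a * b)"
    and proj_mult_le: "p \<in> P \<Longrightarrow> p * b \<sqsubseteq>\<^bsub>proj_order P\<^esub> b"
begin

lemma partial_order_proj_order: "partial_order (proj_order P)"
proof unfold_locales
  show "x \<sqsubseteq>\<^bsub>proj_order P\<^esub> x" for x
    using source_exists[of x] by (force simp: is_source_proj_def least_def proj_order_def)
  show "x \<sqsubseteq>\<^bsub>proj_order P\<^esub> w"
    if "x \<sqsubseteq>\<^bsub>proj_order P\<^esub> y" "y \<sqsubseteq>\<^bsub>proj_order P\<^esub> w" for x y w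
    using that proj_closed by (auto simp: proj_order_def mult.assoc)
  show "x .=\<^bsub>proj_order P\<^esub> y"
    if "x \<sqsubseteq>\<^bsub>proj_order P\<^esub> y" "y \<sqsubseteq>\<^bsub>proj_order P\<^esub> x" for x y
    using proj_order_antisym[OF that] by (simp add: proj_order_def)
qed (auto simp: proj_order_def)

lemma is_source_source_proj: "is_source_proj P a (source_proj P a)"
  unfolding source_proj_def
  using source_exists source_proj_unique by (metis theI)

end

text \<open>In a semi-Boolean algebra two elements have a join iff they have an upper bound, so
  \<open>join_mult\<close> says that \<open>(a \<or> b) c = a c \<or> b c\<close> for all bounded pairs \<open>a, b\<close>.\<close>

locale semi_boolean_restriction_semigroup = restriction_semigroup P
  for P :: "'a::semigroup_mult set" +
  fixes z :: 'a
  assumes zero_proj: "z \<in> P"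
    and zero_mult: "z * b = z"
    and semi_boolean: "semi_boolean_algebra (proj_order P)"
    and join_mult: "is_lub (proj_order P) j {a, b}
      \<Longrightarrow> is_lub (proj_order P) (j * c) {a * c, b * c}"

definition inverses :: "'a::semigroup_mult set \<Rightarrow> 'a \<Rightarrow> 'a \<Rightarrow> bool" where
  "inverses P a b \<longleftrightarrow>
     is_range_proj P a (a * b) \<and> is_source_proj P b (a * b) \<and>
     is_range_proj P b (b * a) \<and> is_source_proj P a (b * a)"

definition invertibles :: "'a::semigroup_mult set \<Rightarrow> 'a set" where
  "invertibles P = {a. \<exists>b. inverses P a b}"


section \<open>Semicategories and groupoids\<close>

record 'a partial_magma = "'a partial_object" +
  composable :: "('a \<times> 'a) set"
  pmult :: "'a \<Rightarrow> 'a \<Rightarrow> 'a"  (infixl \<open>\<cdot>\<index>\<close> 70)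

locale semigroupoid =
  fixes S (structure)
  assumes composable_carrier: "composable S \<subseteq> carrier S \<times> carrier S"
    and pmult_closed: "(a, b) \<in> composable S \<Longrightarrow> a \<cdot> b \<in> carrier S"
    and assoc_defined: "\<lbrakk>a \<in> carrier S; b \<in> carrier S; c \<in> carrier S\<rbrakk> \<Longrightarrow>
      (a, b) \<in> composable S \<and> (a \<cdot> b, c) \<in> composable S \<longleftrightarrow>
      (b, c) \<in> composable S \<and> (a, b \<cdot> c) \<in> composable S"
    and assoc: "\<lbrakk>(a, b) \<in> composable S; (a \<cdot> b, c) \<in> composable S\<rbrakk> \<Longrightarrow>
      (a \<cdot> b) \<cdot> c = a \<cdot> (b \<cdot> c)"

definition punits :: "('a, 'b) partial_magma_scheme \<Rightarrow> 'a set" where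
  "punits S = {u \<in> carrier S. \<forall>a\<in>carrier S.
     ((u, a) \<in> composable S \<longrightarrow> u \<cdot>\<^bsub>S\<^esub> a = a) \<and>
     ((a, u) \<in> composable S \<longrightarrow> a \<cdot>\<^bsub>S\<^esub> u = a)}"

definition is_source_unit :: "('a, 'b) partial_magma_scheme \<Rightarrow> 'a \<Rightarrow> 'a \<Rightarrow> bool" where
  "is_source_unit S a u \<longleftrightarrow> u \<in> punits S \<and> (a, u) \<in> composable S"

definition is_range_unit :: "('a, 'b) partial_magma_scheme \<Rightarrow> 'a \<Rightarrow> 'a \<Rightarrow> bool" where
  "is_range_unit S a u \<longleftrightarrow> u \<in> punits S \<and> (u, a) \<in> composable S"

lemma (in semigroupoid) source_unit_unique:
  assumes "is_source_unit S a u" "is_source_unit S a v"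
  shows "u = v"
proof -
  have u: "u \<in> punits S" "(a, u) \<in> composable S" and v: "v \<in> punits S" "(a, v) \<in> composable S"
    using assms by (auto simp: is_source_unit_def)
  have c: "a \<in> carrier S" "u \<in> carrier S" "v \<in> carrier S"
    using u v composable_carrier by auto
  have "a \<cdot> u = a" using u c by (auto simp: punits_def)
  then have "(u, v) \<in> composable S" using assoc_defined[of a u v] u v c by simp
  then have "u \<cdot> v = v" "u \<cdot> v = u" using u v c by (auto simp: punits_def)
  then show ?thesis by simp
qed

lemma (in semigroupoid) range_unit_unique:
  assumes "is_range_unit S a u" "is_range_unit S a v"
  shows "u = v"
proof -
  have u: "u \<in> punits S" "(u, a) \<in> composable S" and v: "v \<in> punits S" "(v, a) \<in> composable S"
    using assms by (auto simp: is_range_unit_def)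
  have c: "a \<in> carrier S" "u \<in> carrier S" "v \<in> carrier S"
    using u v composable_carrier by auto
  have "v \<cdot> a = a" using v c by (auto simp: punits_def)
  then have "(u, v) \<in> composable S" using assoc_defined[of u v a] u v c by simp
  then have "u \<cdot> v = v" "u \<cdot> v = u" using u v c by (auto simp: punits_def)
  then show ?thesis by simp
qed

locale semicategory = semigroupoid +
  assumes source_unit_exists: "a \<in> carrier S \<Longrightarrow> \<exists>u. is_source_unit S a u"
    and composable_iff: "\<lbrakk>a \<in> carrier S; b \<in> carrier S\<rbrakk> \<Longrightarrow>
      (a, b) \<in> composable S \<longleftrightarrow> (\<exists>u. is_range_unit S b u \<and> is_source_unit S a u)"

definition pinverses :: "('a, 'b) partial_magma_scheme \<Rightarrow> 'a \<Rightarrow> 'a \<Rightarrow> bool" where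
  "pinverses S a b \<longleftrightarrow>
     (a, b) \<in> composable S \<and> (b, a) \<in> composable S \<and>
     is_range_unit S a (a \<cdot>\<^bsub>S\<^esub> b) \<and> is_source_unit S b (a \<cdot>\<^bsub>S\<^esub> b) \<and>
     is_range_unit S b (b \<cdot>\<^bsub>S\<^esub> a) \<and> is_source_unit S a (b \<cdot>\<^bsub>S\<^esub> a)"

locale groupoid = semicategory +
  assumes inverse_exists: "a \<in> carrier S \<Longrightarrow> \<exists>b\<in>carrier S. pinverses S a b"


section \<open>The ultrafilter semicategory\<close>

definition ultrafilter_semicategory ::
    "'a::semigroup_mult set \<Rightarrow> 'a \<Rightarrow> 'a set partial_magma" where
  "ultrafilter_semicategory P z =
     \<lparr>carrier = {U. ultrafilter (proj_order P) U},
      composable = {(V, W). ultrafilter (proj_order P) V \<and> ultrafilter (proj_order P) W \<and>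
                            z \<notin> {v * w | v w. v \<in> V \<and> w \<in> W}},
      pmult = (\<lambda>V W. {c. \<exists>v\<in>V. \<exists>w\<in>W. v * w \<sqsubseteq>\<^bsub>proj_order P\<^esub> c})\<rparr>"

end

theory Submission
  imports Defs
begin

text \<open>
  Both sides say that every ultrafilter contains an invertible element. For finite joins this is
  the usual compactness argument: an ultrafilter is prime, so it meets the finite set of joinands
  of any of its members; conversely, if \<open>c\<close> is not a finite join of invertibles, then the
  relative complements in \<open>c\<close> of such joins generate a proper filter, and an ultrafilter extending
  it contains \<open>c\<close> but no invertible, as the invertibles form a down-set. For the groupoid property,
  the units of \<open>\<U>(B)\<close> are the ultrafilters containing a projection. If \<open>W\<close> is inverse to \<open>V\<close>,
  then \<open>v w\<close> and \<open>w v\<close> are projections for some \<open>v \<in> V\<close>, \<open>w \<in> W\<close>, and \<open>v w v \<in> V\<close> is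
  invertible. If \<open>a \<in> V\<close> has an inverse \<open>b\<close>, then the up-closure of \<open>{s(v) b | v \<in> V}\<close> is
  inverse to \<open>V\<close>.
\<close>

section \<open>Ultrafilters in semilattices with zero\<close>

locale semilattice_zero = lower_semilattice L for L (structure) +
  fixes z
  assumes zero_closed: "z \<in> carrier L"
    and zero_le: "x \<in> carrier L \<Longrightarrow> z \<sqsubseteq> x"
begin

text \<open>This is \<open>x \<sqinter> y = z\<close>, put in terms of common lower bounds, which
  are easier to handle in the semigroup than meets.\<close>

definition disjnt_elems :: "'a \<Rightarrow> 'a \<Rightarrow> bool" where
  "disjnt_elems x y \<longleftrightarrow> (\<forall>d\<in>carrier L. d \<sqsubseteq> x \<longrightarrow> d \<sqsubseteq> y \<longrightarrow> d = z)"

lemma le_zero: "\<lbrakk>x \<in> carrier L; x \<sqsubseteq> z\<rbrakk> \<Longrightarrow> x = z"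
  using zero_closed zero_le le_antisym by blast

lemma disjnt_elemsD:
  "\<lbrakk>disjnt_elems x y; d \<in> carrier L; d \<sqsubseteq> x; d \<sqsubseteq> y\<rbrakk> \<Longrightarrow> d = z"
  by (auto simp: disjnt_elems_def)

lemma disjnt_elems_commute: "disjnt_elems x y \<longleftrightarrow> disjnt_elems y x"
  by (auto simp: disjnt_elems_def)

lemma disjnt_elems_mono:
  "\<lbrakk>disjnt_elems x y; x \<in> carrier L; y \<in> carrier L; x' \<in> carrier L; y' \<in> carrier L;
    x' \<sqsubseteq> x; y' \<sqsubseteq> y\<rbrakk> \<Longrightarrow> disjnt_elems x' y'"
  unfolding disjnt_elems_def using le_trans by meson

lemma filter_closed: "\<lbrakk>order_filter L F; a \<in> F\<rbrakk> \<Longrightarrow> a \<in> carrier L"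
  by (auto simp: order_filter_def)

lemma filter_up: "\<lbrakk>order_filter L F; a \<in> F; b \<in> carrier L; a \<sqsubseteq> b\<rbrakk> \<Longrightarrow> b \<in> F"
  by (auto simp: order_filter_def)

lemma filter_lower_bound:
  assumes "order_filter L F" "a \<in> F" "b \<in> F"
  obtains c where "c \<in> F" "c \<in> carrier L" "c \<sqsubseteq> a" "c \<sqsubseteq> b"
proof -
  obtain c where c: "c \<in> F" "c \<sqsubseteq> a" "c \<sqsubseteq> b"
    using assms unfolding order_filter_def by blast
  from c(1) filter_closed[OF assms(1) c(1)] c(2,3) show thesis
    by (rule that)
qed

text \<open>An up-set containing the minimum \<open>z\<close> is the whole carrier, so properness
  amounts to avoiding \<open>z\<close>.\<close>

lemma proper_filter_iff: "proper_filter L F \<longleftrightarrow> order_filter L F \<and> z \<notin> F"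
proof
  assume F: "proper_filter L F"
  then have f: "order_filter L F" by (simp add: proper_filter_def)
  have "z \<notin> F"
  proof
    assume "z \<in> F"
    then have "carrier L \<subseteq> F" using filter_up[OF f] zero_le by blast
    then show False using F f by (auto simp: proper_filter_def order_filter_def)
  qed
  with f show "order_filter L F \<and> z \<notin> F" by simp
qed (use zero_closed in \<open>auto simp: proper_filter_def\<close>)

lemma ultrafilter_filter: "ultrafilter L U \<Longrightarrow> order_filter L U"
  by (auto simp: ultrafilter_def proper_filter_def)

lemma ultrafilter_not_zero: "ultrafilter L U \<Longrightarrow> z \<notin> U"
  by (auto simp: ultrafilter_def proper_filter_iff)

lemma ultrafilter_ex: "ultrafilter L U \<Longrightarrow> \<exists>a. a \<in> U"
  using ultrafilter_filter[of U] by (auto simp: order_filter_def)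

lemma ultrafilter_maximal:
  "\<lbrakk>ultrafilter L U; proper_filter L G; U \<subseteq> G\<rbrakk> \<Longrightarrow> G = U"
  by (auto simp: ultrafilter_def)

lemma not_disjnt_in_ultrafilter:
  assumes U: "ultrafilter L U" and ab: "a \<in> U" "b \<in> U"
  shows "\<not> disjnt_elems a b"
proof
  assume d: "disjnt_elems a b"
  obtain c where "c \<in> U" "c \<in> carrier L" "c \<sqsubseteq> a" "c \<sqsubseteq> b"
    using filter_lower_bound[OF ultrafilter_filter[OF U] ab] .
  with disjnt_elemsD[OF d] ultrafilter_not_zero[OF U] show False by blast
qed

text \<open>Otherwise the filter generated by \<open>U\<close> and \<open>b\<close> would be proper
  and strictly larger than \<open>U\<close>, against maximality.\<close>

lemma ultrafilter_decides:
  assumes U: "ultrafilter L U" and b: "b \<in> carrier L" "b \<notin> U"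
  obtains c where "c \<in> U" "disjnt_elems c b"
proof (rule ccontr)
  assume neg: "\<not> thesis"
  define G where "G = {x \<in> carrier L. \<exists>u\<in>U. u \<sqinter> b \<sqsubseteq> x}"
  note f = ultrafilter_filter[OF U]
  note fc = filter_closed[OF f]
  have "order_filter L G"
    unfolding order_filter_def
  proof (intro conjI ballI impI)
    show "G \<subseteq> carrier L" by (auto simp: G_def)
    obtain u where "u \<in> U" using ultrafilter_ex[OF U] by blast
    then have "u \<sqinter> b \<in> G" using b fc unfolding G_def by (auto intro: bexI[of _ u])
    then show "G \<noteq> {}" by blast
  next
    fix x y assume xy: "x \<in> G" "y \<in> carrier L" "x \<sqsubseteq> y"
    then obtain u where u: "u \<in> U" "u \<sqinter> b \<sqsubseteq> x" "x \<in> carrier L" by (auto simp: G_def)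
    then have "u \<sqinter> b \<sqsubseteq> y" using le_trans[OF u(2) xy(3)] b fc xy(2) by simp
    then show "y \<in> G" using u xy(2) by (auto simp: G_def)
  next
    fix x y assume xy: "x \<in> G" "y \<in> G"
    then obtain u v where uv: "u \<in> U" "v \<in> U" "u \<sqinter> b \<sqsubseteq> x" "v \<sqinter> b \<sqsubseteq> y"
      by (auto simp: G_def)
    obtain w where w: "w \<in> U" "w \<in> carrier L" "w \<sqsubseteq> u" "w \<sqsubseteq> v"
      using filter_lower_bound[OF f uv(1,2)] .
    have mc: "w \<sqinter> b \<in> carrier L" using w b by simp
    have meet: "w \<sqinter> b \<sqsubseteq> t" if "t' \<in> U" "w \<sqsubseteq> t'" "t' \<sqinter> b \<sqsubseteq> t" "t \<in> carrier L" for t t'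
    proof -
      have t': "t' \<in> carrier L" using fc that(1) .
      have "w \<sqinter> b \<sqsubseteq> t'" using le_trans[OF meet_left that(2)] w b t' mc by simp
      then have "w \<sqinter> b \<sqsubseteq> t' \<sqinter> b" using meet_le[OF _ meet_right] w b t' mc by simp
      then show ?thesis using le_trans[OF _ that(3)] t' b mc that(4) by simp
    qed
    have "w \<sqinter> b \<sqsubseteq> x" "w \<sqinter> b \<sqsubseteq> y"
      using meet[OF uv(1) w(3) uv(3)] meet[OF uv(2) w(4) uv(4)] xy by (auto simp: G_def)
    moreover have "w \<sqinter> b \<in> G" using w mc by (auto simp: G_def)
    ultimately show "\<exists>c\<in>G. c \<sqsubseteq> x \<and> c \<sqsubseteq> y" by blast
  qed
  moreover have "z \<notin> G"
  proof
    assume "z \<in> G"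
    then obtain u where u: "u \<in> U" "u \<sqinter> b \<sqsubseteq> z" by (auto simp: G_def)
    then have uc: "u \<in> carrier L" using fc by blast
    have "disjnt_elems u b"
      unfolding disjnt_elems_def
    proof (intro ballI impI)
      fix d assume d: "d \<in> carrier L" "d \<sqsubseteq> u" "d \<sqsubseteq> b"
      then have "d \<sqsubseteq> u \<sqinter> b" using meet_le uc b by blast
      then show "d = z" using le_zero[OF d(1)] le_trans[OF _ u(2) d(1)] uc b zero_closed by simp
    qed
    with neg u that show False by blast
  qed
  ultimately have "proper_filter L G" by (simp add: proper_filter_iff)
  moreover have "U \<subseteq> G" using b fc meet_left unfolding G_def by blast
  ultimately have "G = U" using ultrafilter_maximal[OF U] by blast
  moreover have "b \<in> G" using ultrafilter_ex[OF U] b fc meet_right unfolding G_def by blast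
  ultimately show False using b by simp
qed

text \<open>It suffices to decide the elements below a single member \<open>a\<close>, because every filter
  containing \<open>a\<close> is generated by its members below \<open>a\<close>.\<close>

lemma ultrafilterI:
  assumes F: "order_filter L F" "z \<notin> F" and a: "a \<in> F"
    and dec: "\<And>b. \<lbrakk>b \<in> carrier L; b \<sqsubseteq> a; b \<notin> F\<rbrakk> \<Longrightarrow> \<exists>c\<in>F. disjnt_elems c b"
  shows "ultrafilter L F"
  unfolding ultrafilter_def
proof (intro conjI allI impI)
  show "proper_filter L F" using F by (simp add: proper_filter_iff)
next
  fix G assume G: "proper_filter L G" "F \<subseteq> G"
  then have g: "order_filter L G" "z \<notin> G" by (simp_all add: proper_filter_iff)
  have "x \<in> F" if x: "x \<in> G" for x
  proof -
    obtain b where b: "b \<in> G" "b \<in> carrier L" "b \<sqsubseteq> x" "b \<sqsubseteq> a"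
      using filter_lower_bound[OF g(1) x, of a] a G by blast
    have "b \<in> F"
    proof (rule ccontr)
      assume "b \<notin> F"
      then obtain c where c: "c \<in> F" "disjnt_elems c b" using dec b by blast
      obtain d where "d \<in> G" "d \<in> carrier L" "d \<sqsubseteq> c" "d \<sqsubseteq> b"
        using filter_lower_bound[OF g(1), of c b] c b G by blast
      then show False using disjnt_elemsD[OF c(2)] g by blast
    qed
    then show ?thesis using filter_up[OF F(1)] b filter_closed[OF g(1) x] by blast
  qed
  with G show "G = F" by blast
qed

text \<open>Zorn's lemma: the union of a nonempty chain of filters avoiding \<open>z\<close> is
  again such a filter.\<close>

lemma ultrafilter_extension:
  assumes F: "order_filter L F" "z \<notin> F"
  obtains U where "ultrafilter L U" "F \<subseteq> U"
proof -
  define A where "A = {G. proper_filter L G \<and> F \<subseteq> G}"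
  have "\<exists>M\<in>A. \<forall>X\<in>A. M \<subseteq> X \<longrightarrow> X = M"
  proof (rule subset_Zorn_nonempty)
    show "A \<noteq> {}" using F by (auto simp: A_def proper_filter_iff)
  next
    fix C assume ne: "C \<noteq> {}" and "subset.chain A C"
    then have C: "C \<subseteq> A" "\<And>X Y. \<lbrakk>X \<in> C; Y \<in> C\<rbrakk> \<Longrightarrow> X \<subseteq> Y \<or> Y \<subseteq> X"
      by (auto simp: subset_chain_def)
    have f: "order_filter L X" "z \<notin> X" "F \<subseteq> X" if "X \<in> C" for X
      using that C(1) by (auto simp: A_def proper_filter_iff)
    have "order_filter L (\<Union>C)"
      unfolding order_filter_def
    proof (intro conjI ballI impI)
      show "\<Union>C \<subseteq> carrier L" using f(1) filter_closed by blast
      show "\<Union>C \<noteq> {}" using ne f(3) F(1) by (fastforce simp: order_filter_def)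
    next
      fix a b assume "a \<in> \<Union>C" "b \<in> carrier L" "a \<sqsubseteq> b"
      then show "b \<in> \<Union>C" using f(1) filter_up by blast
    next
      fix a b assume "a \<in> \<Union>C" "b \<in> \<Union>C"
      then obtain X where "X \<in> C" "a \<in> X" "b \<in> X" using C(2) by blast
      then show "\<exists>c\<in>\<Union>C. c \<sqsubseteq> a \<and> c \<sqsubseteq> b" using f(1) filter_lower_bound by (metis UnionI)
    qed
    moreover have "z \<notin> \<Union>C" "F \<subseteq> \<Union>C" using ne f by blast+
    ultimately show "\<Union>C \<in> A" by (simp add: A_def proper_filter_iff)
  qed
  then obtain M where M: "M \<in> A" "\<And>X. \<lbrakk>X \<in> A; M \<subseteq> X\<rbrakk> \<Longrightarrow> X = M" by blast
  have "ultrafilter L M"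
    unfolding ultrafilter_def
  proof (intro conjI allI impI)
    show "proper_filter L M" using M(1) by (simp add: A_def)
    show "G = M" if "proper_filter L G" "M \<subseteq> G" for G
      using that M by (auto simp: A_def)
  qed
  then show thesis using M(1) that by (auto simp: A_def)
qed

end

section \<open>Relative complements and finite joins in semi-Boolean algebras\<close>

locale semi_boolean_zero = semi_boolean_algebra + semilattice_zero
begin

text \<open>\<open>u\<close> is the complement of \<open>x\<close> in the Boolean algebra below
  \<open>c\<close>. The last fact makes \<open>c\<close> the join of \<open>x\<close> and
  \<open>u\<close> in the whole poset: an upper bound \<open>d\<close> outside the ideal is replaced
  by \<open>d \<sqinter> c\<close>.\<close>

lemma relative_complement:
  assumes xc: "x \<in> carrier L" "c \<in> carrier L" "x \<sqsubseteq> c"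
  obtains u where "u \<in> carrier L" "u \<sqsubseteq> c" "disjnt_elems x u"
    "\<And>e. \<lbrakk>e \<in> carrier L; e \<sqsubseteq> c; disjnt_elems e x\<rbrakk> \<Longrightarrow> e \<sqsubseteq> u"
    "\<And>d. \<lbrakk>d \<in> carrier L; x \<sqsubseteq> d; u \<sqsubseteq> d\<rbrakk> \<Longrightarrow> c \<sqsubseteq> d"
proof -
  define I where "I = principal_ideal L c"
  interpret I: boolean_lattice I
    unfolding I_def using ideal_boolean[OF xc(2)] .
  have cI: "a \<in> carrier I \<longleftrightarrow> a \<in> carrier L \<and> a \<sqsubseteq> c" for a
    by (auto simp: I_def principal_ideal_def)
  have leI: "a \<sqsubseteq>\<^bsub>I\<^esub> b \<longleftrightarrow> a \<sqsubseteq> b" for a b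
    by (simp add: I_def principal_ideal_def)
  have zI: "\<bottom>\<^bsub>I\<^esub> = z"
    using I.bottom_eq[of z] cI leI zero_closed zero_le xc by auto
  have tI: "\<top>\<^bsub>I\<^esub> = c"
    using I.top_eq[of c] cI leI xc by auto
  obtain u where u: "u \<in> carrier I" "x \<sqinter>\<^bsub>I\<^esub> u = z" "x \<squnion>\<^bsub>I\<^esub> u = c"
    using I.complemented[of x] xc zI tI cI by auto
  have xI: "x \<in> carrier I" using xc cI by simp
  show thesis
  proof (rule that[of u])
    show "u \<in> carrier L" "u \<sqsubseteq> c" using u cI by auto
    show "disjnt_elems x u"
      unfolding disjnt_elems_def
    proof (intro ballI impI)
      fix d assume d: "d \<in> carrier L" "d \<sqsubseteq> x" "d \<sqsubseteq> u"
      have dI: "d \<in> carrier I" using cI xc d le_trans by blast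
      have "d \<sqsubseteq>\<^bsub>I\<^esub> x \<sqinter>\<^bsub>I\<^esub> u"
        by (rule I.meet_le[OF _ _ xI u(1) dI]) (use d leI in auto)
      then show "d = z" using u d leI le_zero by simp
    qed
  next
    fix e assume e: "e \<in> carrier L" "e \<sqsubseteq> c" "disjnt_elems e x"
    then have eI: "e \<in> carrier I" using cI by simp
    have "e \<sqinter>\<^bsub>I\<^esub> x \<in> carrier L" "e \<sqinter>\<^bsub>I\<^esub> x \<sqsubseteq> e" "e \<sqinter>\<^bsub>I\<^esub> x \<sqsubseteq> x"
      using I.meet_closed[OF eI xI] I.meet_left[OF eI xI] I.meet_right[OF eI xI] cI leI by auto
    then have ex: "e \<sqinter>\<^bsub>I\<^esub> x = z" using disjnt_elemsD[OF e(3)] by blast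
    have cc: "c \<in> carrier I" using cI xc by simp
    have eu: "e \<sqinter>\<^bsub>I\<^esub> u \<in> carrier I" using eI u by simp
    \<comment> \<open>By distributivity \<open>e\<close> is the join of its meets with
      \<open>x\<close> and \<open>u\<close>, and the former is \<open>z\<close>.\<close>
    have "e \<sqsubseteq>\<^bsub>I\<^esub> e \<sqinter>\<^bsub>I\<^esub> c" 
      by (rule I.meet_le[OF _ _ eI cc eI]) (use e leI in auto)
    also have "e \<sqinter>\<^bsub>I\<^esub> c = (e \<sqinter>\<^bsub>I\<^esub> x) \<squnion>\<^bsub>I\<^esub> (e \<sqinter>\<^bsub>I\<^esub> u)"
      using I.distrib[OF eI xI u(1)] u(3) by simp
    also have "\<dots> = e \<sqinter>\<^bsub>I\<^esub> u"
      using ex I.bottom_join[OF eu] zI I.eq_is_equal by simp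
    finally have "e \<sqsubseteq>\<^bsub>I\<^esub> e \<sqinter>\<^bsub>I\<^esub> u" .
    then have "e \<sqsubseteq>\<^bsub>I\<^esub> u" using I.meet_right[OF eI u(1)] I.le_trans eI u(1) eu by blast
    then show "e \<sqsubseteq> u" using leI by simp
  next
    fix d assume d: "d \<in> carrier L" "x \<sqsubseteq> d" "u \<sqsubseteq> d"
    have m: "d \<sqinter> c \<in> carrier I" using d xc cI meet_right by simp
    have "x \<sqsubseteq>\<^bsub>I\<^esub> d \<sqinter> c" "u \<sqsubseteq>\<^bsub>I\<^esub> d \<sqinter> c"
      using d xc u cI leI meet_le by auto
    then have "x \<squnion>\<^bsub>I\<^esub> u \<sqsubseteq>\<^bsub>I\<^esub> d \<sqinter> c" using I.join_le xI u m by blast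
    then have "c \<sqsubseteq> d \<sqinter> c" using u leI by simp
    then show "c \<sqsubseteq> d" using d xc le_trans meet_left by (meson meet_closed)
  qed
qed

text \<open>If no joinand lay in \<open>U\<close>, some \<open>c\<close> in \<open>U\<close> below
  \<open>v\<close> would be disjoint from all of them. Its relative complement in \<open>v\<close>
  would bound \<open>F\<close>, hence \<open>v\<close>, hence \<open>c\<close>, forcing
  \<open>c = z\<close>.\<close>

lemma ultrafilter_finite_prime:
  assumes U: "ultrafilter L U" and v: "v \<in> U"
    and F: "finite F" "F \<subseteq> carrier L" and lub: "is_lub L v F"
  shows "F \<inter> U \<noteq> {}"
proof
  assume empty: "F \<inter> U = {}"
  note f = ultrafilter_filter[OF U]
  note fc = filter_closed[OF f]
  have vc: "v \<in> carrier L" using fc v .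
  \<comment> \<open>Stated for all subsets of \<open>F\<close> to allow induction; each new joinand
    shrinks \<open>c\<close> further inside \<open>U\<close>.\<close>
  have "\<exists>c\<in>U. c \<sqsubseteq> v \<and> (\<forall>b\<in>G. disjnt_elems b c)" if "G \<subseteq> F" for G
    using finite_subset[OF that F(1)] that
  proof (induction G rule: finite_induct)
    case empty
    then show ?case using v vc by auto
  next
    case (insert b G)
    then obtain c where c: "c \<in> U" "c \<sqsubseteq> v" "\<forall>b\<in>G. disjnt_elems b c" by auto
    have b: "b \<in> carrier L" "b \<notin> U" using insert.prems F empty \<open>F \<inter> U = {}\<close> by auto
    obtain d where d: "d \<in> U" "disjnt_elems d b" using ultrafilter_decides[OF U b] .
    obtain e where e: "e \<in> U" "e \<in> carrier L" "e \<sqsubseteq> c" "e \<sqsubseteq> d"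
      using filter_lower_bound[OF f c(1) d(1)] .
    have cd: "c \<in> carrier L" "d \<in> carrier L" using c d fc by auto
    have "disjnt_elems b e"
      using disjnt_elems_mono[OF d(2) cd(2) b(1) e(2) b(1) e(4)] b(1) disjnt_elems_commute by simp
    moreover have "disjnt_elems g e" if "g \<in> G" for g
    proof -
      have "g \<in> carrier L" using that insert.prems F by auto
      then show ?thesis using disjnt_elems_mono[of g c g e] that c cd e by simp
    qed
    moreover have "e \<sqsubseteq> v" using e c cd vc le_trans by blast
    ultimately show ?case using e by auto
  qed
  from this[OF subset_refl] obtain c
    where c: "c \<in> U" "c \<sqsubseteq> v" "\<And>b. b \<in> F \<Longrightarrow> disjnt_elems b c" by blast
  have cc: "c \<in> carrier L" using c fc by blast
  obtain u where u: "u \<in> carrier L" "disjnt_elems c u"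
    "\<And>e. \<lbrakk>e \<in> carrier L; e \<sqsubseteq> v; disjnt_elems e c\<rbrakk> \<Longrightarrow> e \<sqsubseteq> u"
    using relative_complement[OF cc vc c(2)] by metis
  have "b \<sqsubseteq> u" if "b \<in> F" for b
    using u(3)[of b] c(3)[OF that] that F(2) least_Upper_above[OF lub that F(2)] by auto
  then have "u \<in> Upper L F" using u(1) by (auto simp: Upper_def)
  then have "v \<sqsubseteq> u" by (rule least_le[OF lub])
  then have "c \<sqsubseteq> u" using c(2) cc vc u(1) le_trans by blast
  then have "c = z" using disjnt_elemsD[OF u(2) cc] cc by simp
  then show False using c(1) ultrafilter_not_zero[OF U] by simp
qed

text \<open>The filter \<open>F\<close> of the proof consists of the elements that dominate the relative complement
  in \<open>c\<close> of the join of some finite \<open>G \<subseteq> A\<close>; it is proper unless \<open>c\<close> is such a join.\<close>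

lemma finite_join_if_ultrafilters_meet:
  assumes c: "c \<in> carrier L" and A: "A \<subseteq> carrier L"
    and down: "\<And>a b. \<lbrakk>a \<in> A; b \<in> carrier L; b \<sqsubseteq> a\<rbrakk> \<Longrightarrow> b \<in> A"
    and meets: "\<And>U. \<lbrakk>ultrafilter L U; c \<in> U\<rbrakk> \<Longrightarrow> A \<inter> U \<noteq> {}"
  shows "\<exists>G. finite G \<and> G \<subseteq> A \<and> is_lub L c G"
proof (rule ccontr)
  assume neg: "\<not> ?thesis"
  \<comment> \<open>This avoids forming the join of \<open>G\<close>: dominating its relative
    complement in \<open>c\<close> means dominating each \<open>e\<close> below \<open>c\<close>
    that is disjoint from every member of \<open>G\<close>.\<close>
  define ok where "ok G u \<longleftrightarrow> finite G \<and> G \<subseteq> A \<and> (\<forall>g\<in>G. g \<sqsubseteq> c) \<and>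
    (\<forall>e\<in>carrier L. e \<sqsubseteq> c \<longrightarrow> (\<forall>g\<in>G. disjnt_elems e g) \<longrightarrow> e \<sqsubseteq> u)" for G u
  define F where "F = {u \<in> carrier L. \<exists>G. ok G u}"
  have f: "order_filter L F"
    unfolding order_filter_def
  proof (intro conjI ballI impI)
    show "F \<subseteq> carrier L" by (auto simp: F_def)
    have "ok {} c" by (simp add: ok_def)
    then show "F \<noteq> {}" using c by (auto simp: F_def)
  next
    fix a b assume a: "a \<in> F" and b: "b \<in> carrier L" "a \<sqsubseteq> b"
    then obtain G where "ok G a" "a \<in> carrier L" by (auto simp: F_def)
    then have "ok G b" using b le_trans unfolding ok_def by blast
    then show "b \<in> F" using b by (auto simp: F_def)
  next
    fix a b assume "a \<in> F" "b \<in> F"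
    then obtain G H where ab: "ok G a" "ok H b" "a \<in> carrier L" "b \<in> carrier L"
      by (auto simp: F_def)
    then have "ok (G \<union> H) (a \<sqinter> b)" by (auto simp: ok_def intro: meet_le)
    then have "a \<sqinter> b \<in> F" using ab by (auto simp: F_def)
    then show "\<exists>d\<in>F. d \<sqsubseteq> a \<and> d \<sqsubseteq> b" using ab meet_left meet_right by blast
  qed
  have "z \<notin> F"
  proof
    assume "z \<in> F"
    then obtain G where G: "ok G z" by (auto simp: F_def)
    then have GA: "finite G" "G \<subseteq> A" "\<And>g. g \<in> G \<Longrightarrow> g \<sqsubseteq> c" and GL: "G \<subseteq> carrier L"
      using A by (auto simp: ok_def)
    have "c \<sqsubseteq> d" if d: "d \<in> carrier L" "\<And>g. g \<in> G \<Longrightarrow> g \<sqsubseteq> d" for d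
    proof -
      \<comment> \<open>Only the part of \<open>d\<close> below \<open>c\<close> matters. Its
        complement \<open>u\<close> in \<open>c\<close> is disjoint from all of \<open>G\<close>, so
        \<open>ok G z\<close> forces \<open>u = z\<close>.\<close>
      have dc: "d \<sqinter> c \<in> carrier L" "d \<sqinter> c \<sqsubseteq> c" using d c meet_right by auto
      obtain u where u: "u \<in> carrier L" "u \<sqsubseteq> c" "disjnt_elems (d \<sqinter> c) u"
        "\<And>e. \<lbrakk>e \<in> carrier L; d \<sqinter> c \<sqsubseteq> e; u \<sqsubseteq> e\<rbrakk> \<Longrightarrow> c \<sqsubseteq> e"
        using relative_complement[OF dc(1) c dc(2)] by metis
      have "disjnt_elems u g" if "g \<in> G" for g
      proof -
        have g: "g \<in> carrier L" using that GL by blast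
        then have "g \<sqsubseteq> d \<sqinter> c" using meet_le d GA(3) that c by blast
        then show ?thesis
          using disjnt_elems_mono[OF u(3) dc(1) u(1) g u(1)] u(1) disjnt_elems_commute by simp
      qed
      then have "u \<sqsubseteq> z" using G u(1,2) by (auto simp: ok_def)
      then have "u = z" using le_zero u by simp
      then show ?thesis using u(4)[OF d(1)] meet_left d c zero_le by simp
    qed
    then have "is_lub L c G"
      using c GA(3) GL unfolding least_def Upper_def by blast
    then show False using neg GA by blast
  qed
  with f obtain U where U: "ultrafilter L U" "F \<subseteq> U" by (rule ultrafilter_extension)
  have "ok {} c" by (simp add: ok_def)
  then have cU: "c \<in> U" using c U by (auto simp: F_def)
  then obtain a where a: "a \<in> A" "a \<in> U" using meets U by blast
  obtain b where b: "b \<in> U" "b \<in> carrier L" "b \<sqsubseteq> a" "b \<sqsubseteq> c"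
    using filter_lower_bound[OF ultrafilter_filter[OF U(1)] a(2) cU] .
  obtain u where u: "u \<in> carrier L" "disjnt_elems b u"
    "\<And>e. \<lbrakk>e \<in> carrier L; e \<sqsubseteq> c; disjnt_elems e b\<rbrakk> \<Longrightarrow> e \<sqsubseteq> u"
    using relative_complement[OF b(2) c b(4)] by metis
  \<comment> \<open>\<open>A\<close> is a down-set, so \<open>b\<close> is in \<open>A\<close> and
    its complement \<open>u\<close> is in \<open>F\<close>; then \<open>b\<close> and
    \<open>u\<close> are disjoint members of \<open>U\<close>.\<close>
  have "ok {b} u" using down[OF a(1) b(2,3)] b u by (auto simp: ok_def)
  then have "u \<in> U" using u U by (auto simp: F_def)
  then show False using not_disjnt_in_ultrafilter[OF U(1) b(1)] u by blast
qed

end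

section \<open>Multiplication and the order\<close>

lemma carrier_proj_order [simp]: "carrier (proj_order P) = UNIV"
  by (simp add: proj_order_def)

context restriction_semigroup
begin

abbreviation src :: "'a \<Rightarrow> 'a" where
  "src \<equiv> source_proj P"

abbreviation prec :: "'a \<Rightarrow> 'a \<Rightarrow> bool"  (infix \<open>\<preceq>\<close> 50) where
  "a \<preceq> b \<equiv> a \<sqsubseteq>\<^bsub>proj_order P\<^esub> b"

lemma prec_iff: "a \<preceq> b \<longleftrightarrow> (\<exists>p\<in>P. a = b * p)"
  by (simp add: proj_order_def)

lemma prec_refl: "a \<preceq> a"
  by (rule weak_partial_order.le_refl[OF partial_order.axioms(1)[OF partial_order_proj_order]]) simp

lemma prec_trans: "\<lbrakk>a \<preceq> b; b \<preceq> c\<rbrakk> \<Longrightarrow> a \<preceq> c"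
  by (rule weak_partial_order.le_trans[OF partial_order.axioms(1)[OF partial_order_proj_order]])
    simp_all

section \<open>Source projections and their interplay with the order\<close>

lemma src_proj: "src a \<in> P"
  and mult_src: "a * src a = a"
  using is_source_source_proj[of a] by (auto simp: is_source_proj_def least_def)

text \<open>The minimality of \<open>src a\<close> as an equation, ready for computation.\<close>

lemma src_least:
  assumes "q \<in> P" "a * q = a"
  shows "src a * q = src a"
proof -
  have "src a \<preceq> q"
    using is_source_source_proj[of a] assms by (auto simp: is_source_proj_def least_def)
  then obtain p where p: "p \<in> P" "src a = q * p" by (auto simp: prec_iff)
  then have "src a * q = q * (p * q)" by (simp add: mult.assoc)
  also have "\<dots> = q * q * p" using p assms proj_commute by (metis mult.assoc)
  finally show ?thesis using p assms proj_idem by simp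
qed

text \<open>A projection \<open>p\<close> with \<open>a = b * p\<close> fixes \<open>a\<close>, so
  \<open>p * src a = src a\<close>; thus \<open>src a\<close> can serve as the witness instead of
  \<open>p\<close>.\<close>

lemma prec_src: "a \<preceq> b \<Longrightarrow> b * src a = a"
proof -
  assume "a \<preceq> b"
  then obtain p where p: "p \<in> P" "a = b * p" by (auto simp: prec_iff)
  then have "a * p = a" using proj_idem by (simp add: mult.assoc)
  then have "p * src a = src a" using src_least p proj_commute src_proj by metis
  then show ?thesis using p mult_src by (metis mult.assoc)
qed

lemma mult_proj_prec: "p \<in> P \<Longrightarrow> b * p \<preceq> b"
  by (auto simp: prec_iff)

lemma src_projection: "p \<in> P \<Longrightarrow> src p = p"
  using src_least[of p p] mult_src[of p] proj_idem src_proj proj_commute by metis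

lemma src_mult_proj: "p \<in> P \<Longrightarrow> src (a * p) = src a * p"
  using source_mult[of a p] src_projection proj_closed src_proj by simp

lemma src_mono: "a \<preceq> b \<Longrightarrow> src a \<preceq> src b"
  using prec_src[of a b] src_mult_proj[of "src a" b] src_proj by (metis mult_proj_prec)

lemma prec_mult_proj: "\<lbrakk>a \<preceq> b; p \<in> P; b * p = b\<rbrakk> \<Longrightarrow> a * p = a"
  using prec_src[of a b] proj_commute src_proj by (metis mult.assoc)

lemma prec_mult_src: "a \<preceq> b \<Longrightarrow> a * src b = a"
  using prec_mult_proj mult_src src_proj by blast

lemma prec_fixed: "\<lbrakk>a \<preceq> b; p * b = b\<rbrakk> \<Longrightarrow> p * a = a"
  using prec_src[of a b] by (metis mult.assoc)

lemma prec_proj: "\<lbrakk>p \<in> P; a \<preceq> p\<rbrakk> \<Longrightarrow> a \<in> P"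
  using proj_closed by (auto simp: prec_iff)

lemma prec_projI: "\<lbrakk>p \<in> P; q * p = p; q \<in> P\<rbrakk> \<Longrightarrow> p \<preceq> q"
  by (metis mult_proj_prec)

lemma mult_mono:
  assumes "a \<preceq> b" "c \<preceq> d"
  shows "a * c \<preceq> b * d"
proof -
  obtain p q where p: "p \<in> P" "a = b * p" and q: "q \<in> P" "c = d * q"
    using assms by (auto simp: prec_iff)
  \<comment> \<open>\<open>proj_mult_le\<close> moves \<open>p\<close> to the right of
    \<open>d\<close>, where it merges with \<open>q\<close> into one projection.\<close>
  obtain r where r: "r \<in> P" "p * d = d * r" using proj_mult_le[OF p(1), of d] by (auto simp: prec_iff)
  have "a * c = b * (p * d) * q" using p q by (simp add: mult.assoc)
  also have "\<dots> = b * d * (r * q)" using r by (simp add: mult.assoc)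
  finally show ?thesis using proj_closed r q by (auto simp: prec_iff)
qed

text \<open>Minimality is automatic: a projection \<open>q\<close> fixing \<open>x\<close> on the
  left also fixes \<open>x * y\<close>, so \<open>x * y \<preceq> q\<close>. For sources,
  commutativity in \<open>P\<close> turns right fixing into left fixing.\<close>

lemma inversesI:
  assumes xy: "x * y \<in> P" and yx: "y * x \<in> P" and x: "x * y * x = x" and y: "y * x * y = y"
  shows "inverses P x y"
proof -
  have range: "is_range_proj P u (u * v)" if "u * v \<in> P" "u * v * u = u" for u v
    unfolding is_range_proj_def least_def
    using that prec_projI[of "u * v"] by (auto simp: mult.assoc[symmetric])
  have source: "is_source_proj P u (v * u)" if vu: "v * u \<in> P" and "u * v * u = u" for u v
    unfolding is_source_proj_def least_def
  proof (intro conjI ballI)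
    show "v * u \<in> {q \<in> P. u * q = u}" using that by (simp add: mult.assoc)
    fix q assume "q \<in> {q \<in> P. u * q = u}"
    then have q: "q \<in> P" "u * q = u" by auto
    then have "q * (v * u) = v * u" using vu proj_commute by (metis mult.assoc)
    then show "v * u \<preceq> q" using prec_projI vu q by blast
  qed simp
  show ?thesis
    unfolding inverses_def using assms range source by simp
qed

lemma inversesD:
  assumes "inverses P x y"
  shows "x * y \<in> P" "y * x \<in> P" "x * y * x = x" "y * x * y = y" "src x = y * x" "src y = x * y"
proof -
  have range: "is_range_proj P x (x * y)" "is_range_proj P y (y * x)"
    and source: "is_source_proj P x (y * x)" "is_source_proj P y (x * y)"
    using assms by (auto simp: inverses_def)
  show "x * y \<in> P" "y * x \<in> P" "x * y * x = x" "y * x * y = y"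
    using range unfolding is_range_proj_def least_def by blast+
  show "src x = y * x" "src y = x * y"
    using source source_proj_unique is_source_source_proj by blast+
qed

text \<open>With \<open>p = src x\<close> one has \<open>x = a * p\<close>, and the restriction
  \<open>p * b\<close> inverts it because \<open>p\<close> lies below \<open>b * a\<close>, the
  source of \<open>a\<close>.\<close>

lemma invertibles_down:
  assumes "a \<in> invertibles P" "x \<preceq> a"
  shows "x \<in> invertibles P"
proof -
  obtain b where "inverses P a b" using assms by (auto simp: invertibles_def)
  note ab = inversesD[OF this]
  define p where "p = src x"
  have p: "p \<in> P" "a * p = x" using src_proj prec_src[OF assms(2)] by (auto simp: p_def)
  have pba: "p * (b * a) = p" "b * a * p = p"
    using src_least[OF ab(2)] prec_mult_src[OF assms(2)] ab(2,5) p proj_commute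
    by (auto simp: p_def)
  have xy: "x * (p * b) = a * (p * b)" using p proj_idem by (metis mult.assoc)
  have yx: "p * b * x = p" using pba p proj_idem by (metis mult.assoc)
  have "inverses P x (p * b)"
  proof (rule inversesI)
    have "a * (p * b) \<preceq> a * b" using mult_mono prec_refl proj_mult_le p by blast
    then show "x * (p * b) \<in> P" using xy prec_proj ab(1) by simp
    show "p * b * x \<in> P" using yx p by simp
    show "x * (p * b) * x = x" using yx p proj_idem by (metis mult.assoc)
    show "p * b * x * (p * b) = p * b" using yx p proj_idem by (metis mult.assoc)
  qed
  then show ?thesis by (auto simp: invertibles_def)
qed

end

section \<open>The zero element\<close>

context semi_boolean_restriction_semigroup
begin

text \<open>The element \<open>z * b = z\<close> lies below \<open>b\<close>, so it equals
  \<open>b * src z\<close>, and \<open>src z = z\<close>.\<close>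

lemma mult_zero: "b * z = z"
  using prec_src[OF proj_mult_le[OF zero_proj, of b]] zero_mult src_projection[OF zero_proj] by simp

lemma zero_prec: "z \<preceq> b"
  using mult_proj_prec[OF zero_proj, of b] mult_zero by simp

lemma src_eq_zero: "src a = z \<Longrightarrow> a = z"
  using mult_src[of a] mult_zero by simp

text \<open>An element is \<open>z\<close> exactly when its source is, so \<open>source_mult\<close>
  lets \<open>src a\<close> stand in for \<open>a\<close> in tests for zero.\<close>

lemma mult_eq_zero_iff: "a * b = z \<longleftrightarrow> src a * b = z"
  using source_mult[of a b] src_eq_zero src_projection[OF zero_proj] by metis

end

sublocale semi_boolean_restriction_semigroup \<subseteq> ord: semi_boolean_zero "proj_order P" z
  rewrites "carrier (proj_order P) = UNIV"
    and "\<And>x. x \<in> UNIV \<equiv> True"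
    and "\<And>R. (True \<Longrightarrow> R) \<equiv> Trueprop R"
    and "\<And>R S. (True \<Longrightarrow> PROP R \<Longrightarrow> PROP S) \<equiv> (PROP R \<Longrightarrow> True \<Longrightarrow> PROP S)"
proof -
  interpret semi_boolean_algebra "proj_order P" by (rule semi_boolean)
  show "semi_boolean_zero (proj_order P) z"
    by unfold_locales (auto simp: zero_prec)
qed auto

section \<open>Semicategories\<close>

context semicategory
begin

text \<open>The source unit \<open>u\<close> of \<open>b\<close> is also one for
  \<open>a \<cdot> b\<close>, by associativity, and units decide composability.\<close>

lemma composable_mult_left:
  assumes ab: "(a, b) \<in> composable S" and bc: "(b, c) \<in> composable S"
  shows "(a \<cdot> b, c) \<in> composable S"
proof -
  have car: "a \<in> carrier S" "b \<in> carrier S" "c \<in> carrier S" "a \<cdot> b \<in> carrier S"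
    using assms composable_carrier pmult_closed by auto
  obtain u where u: "is_range_unit S c u" "is_source_unit S b u"
    using composable_iff bc car by blast
  then have bu: "u \<in> carrier S" "u \<in> punits S" "(b, u) \<in> composable S" "b \<cdot> u = b"
    using car by (auto simp: is_source_unit_def punits_def)
  then have "(a \<cdot> b, u) \<in> composable S" using assoc_defined[of a b u] ab car by simp
  then have "is_source_unit S (a \<cdot> b) u" using bu by (simp add: is_source_unit_def)
  then show ?thesis using composable_iff car u by blast
qed

lemma composable_mult_right:
  assumes "(a, b) \<in> composable S" "(b, c) \<in> composable S"
  shows "(a, b \<cdot> c) \<in> composable S"
  using assoc_defined[of a b c] composable_mult_left[OF assms] assms composable_carrier by auto

text \<open>Once the two products are units, they are the right source and range units:
  composability with \<open>a\<close> and \<open>b\<close> follows from that of the factors.\<close>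

lemma pinversesI:
  assumes "(a, b) \<in> composable S" "(b, a) \<in> composable S" "a \<cdot> b \<in> punits S" "b \<cdot> a \<in> punits S"
  shows "pinverses S a b"
  using assms composable_mult_left composable_mult_right
  by (simp add: pinverses_def is_range_unit_def is_source_unit_def)

end

section \<open>The ultrafilter semicategory\<close>

context semi_boolean_restriction_semigroup
begin

abbreviation ultra :: "'a set \<Rightarrow> bool" where
  "ultra \<equiv> ultrafilter (proj_order P)"

abbreviation UB :: "'a set partial_magma" where
  "UB \<equiv> ultrafilter_semicategory P z"

definition src_filter :: "'a set \<Rightarrow> 'a set" where
  "src_filter V = {c. \<exists>v\<in>V. src v \<preceq> c}"

lemma composable_UB:
  "(V, W) \<in> composable UB \<longleftrightarrow> ultra V \<and> ultra W \<and> (\<forall>v\<in>V. \<forall>w\<in>W. v * w \<noteq> z)"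
  unfolding ultrafilter_semicategory_def by (auto simp: eq_commute)

lemma carrier_UB: "V \<in> carrier UB \<longleftrightarrow> ultra V"
  by (simp add: ultrafilter_semicategory_def)

lemma in_pmult_UB: "c \<in> V \<cdot>\<^bsub>UB\<^esub> W \<longleftrightarrow> (\<exists>v\<in>V. \<exists>w\<in>W. v * w \<preceq> c)"
  by (simp add: ultrafilter_semicategory_def)

lemma mult_in_pmult_UB: "\<lbrakk>v \<in> V; w \<in> W\<rbrakk> \<Longrightarrow> v * w \<in> V \<cdot>\<^bsub>UB\<^esub> W"
  using in_pmult_UB prec_refl by blast

lemma ultra_lower_bound:
  assumes "ultra U" "a \<in> U" "b \<in> U"
  obtains c where "c \<in> U" "c \<preceq> a" "c \<preceq> b"
  using ord.filter_lower_bound[OF ord.ultrafilter_filter[OF assms(1)] assms(2,3)] by blast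

lemma ultra_not_zero: "\<lbrakk>ultra U; a \<in> U\<rbrakk> \<Longrightarrow> a \<noteq> z"
  using ord.ultrafilter_not_zero by blast

lemma ultra_decides_below:
  assumes U: "ultra U" and a: "a \<in> U" and b: "b \<notin> U"
  obtains c where "c \<in> U" "c \<preceq> a" "ord.disjnt_elems c b"
proof -
  obtain d where d: "d \<in> U" "ord.disjnt_elems d b" using ord.ultrafilter_decides[OF U b] .
  obtain c where c: "c \<in> U" "c \<preceq> d" "c \<preceq> a" using ultra_lower_bound[OF U d(1) a] .
  show thesis
    using that[OF c(1,3)] ord.disjnt_elems_mono[OF d(2) c(2) prec_refl] .
qed

lemma order_filterI:
  assumes "a \<in> F" "\<And>a b. \<lbrakk>a \<in> F; a \<preceq> b\<rbrakk> \<Longrightarrow> b \<in> F"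
    and "\<And>a b. \<lbrakk>a \<in> F; b \<in> F\<rbrakk> \<Longrightarrow> \<exists>c\<in>F. c \<preceq> a \<and> c \<preceq> b"
  shows "order_filter (proj_order P) F"
  using assms unfolding order_filter_def by auto

text \<open>Below \<open>a\<close>, elements and source projections correspond; in particular \<open>a * p\<close> and
  \<open>c\<close> can only be disjoint if \<open>p\<close> and \<open>src c\<close> are.\<close>

lemma disjnt_src:
  assumes p: "p \<in> P" "src a * p = p" and c: "c \<preceq> a" "ord.disjnt_elems c (a * p)"
  shows "p * src c = z"
proof -
  have "a * (p * src c) = a * p * src c" by (simp add: mult.assoc)
  then have 1: "a * (p * src c) \<preceq> a * p" using mult_proj_prec src_proj by simp
  have "a * (p * src c) = c * p"
    using prec_src[OF c(1)] proj_commute[OF p(1) src_proj[of c]] by (metis mult.assoc)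
  then have 2: "a * (p * src c) \<preceq> c" using mult_proj_prec p by simp
  have "a * (p * src c) = z" using ord.disjnt_elemsD[OF c(2)] 1 2 by blast
  then have "src a * (p * src c) = z" using mult_eq_zero_iff by blast
  then show ?thesis using p(2) by (metis mult.assoc)
qed

lemma src_in_src_filter: "v \<in> V \<Longrightarrow> src v \<in> src_filter V"
  unfolding src_filter_def using prec_refl by blast

text \<open>Only elements \<open>b\<close> below \<open>src a\<close> need deciding, and these are
  projections. Such a \<open>b\<close> is the source of \<open>a * b\<close>, so a \<open>c\<close>
  in \<open>V\<close> below \<open>a\<close> and disjoint from \<open>a * b\<close> has source
  disjoint from \<open>b\<close>.\<close>

lemma ultra_src_filter:
  assumes V: "ultra V"
  shows "ultra (src_filter V)"
proof -
  obtain a where a: "a \<in> V" using ord.ultrafilter_ex[OF V] by blast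
  have f: "order_filter (proj_order P) (src_filter V)"
  proof (rule order_filterI)
    show "src a \<in> src_filter V" using a by (rule src_in_src_filter)
    show "y \<in> src_filter V" if "x \<in> src_filter V" "x \<preceq> y" for x y
      using that prec_trans unfolding src_filter_def by blast
    fix x y assume "x \<in> src_filter V" "y \<in> src_filter V"
    then obtain u v where uv: "u \<in> V" "v \<in> V" "src u \<preceq> x" "src v \<preceq> y"
      by (auto simp: src_filter_def)
    obtain w where w: "w \<in> V" "w \<preceq> u" "w \<preceq> v" using ultra_lower_bound[OF V uv(1,2)] .
    have "src w \<preceq> x" "src w \<preceq> y" using w uv src_mono prec_trans by blast+
    then show "\<exists>c\<in>src_filter V. c \<preceq> x \<and> c \<preceq> y" using src_in_src_filter[OF w(1)] by blast
  qed
  have nz: "z \<notin> src_filter V"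
  proof
    assume "z \<in> src_filter V"
    then obtain v where "v \<in> V" "src v \<preceq> z" by (auto simp: src_filter_def)
    then show False using ord.le_zero src_eq_zero ultra_not_zero[OF V] by blast
  qed
  show ?thesis
  proof (rule ord.ultrafilterI[OF f nz src_in_src_filter[OF a]])
    fix b assume b: "b \<preceq> src a" "b \<notin> src_filter V"
    then have bP: "b \<in> P" using prec_proj src_proj by blast
    have sab: "src a * b = b" using prec_src[OF b(1)] src_projection[OF bP] by simp
    have "a * b \<notin> V"
      using b(2) src_in_src_filter[of "a * b" V] src_mult_proj[OF bP, of a] sab by auto
    then obtain c where c: "c \<in> V" "c \<preceq> a" "ord.disjnt_elems c (a * b)"
      using ultra_decides_below[OF V a] by blast
    have bc: "b * src c = z" using disjnt_src[OF bP sab c(2,3)] .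
    have "ord.disjnt_elems (src c) b"
      unfolding ord.disjnt_elems_def
    proof (intro ballI impI)
      fix d assume d: "d \<preceq> src c" "d \<preceq> b"
      have "b * d = d" using prec_fixed[OF d(2)] proj_idem[OF bP] by simp
      moreover have "src c * d = d" using prec_fixed[OF d(1)] proj_idem[OF src_proj] by simp
      ultimately show "d = z" using bc zero_mult by (metis mult.assoc)
    qed
    then show "\<exists>c\<in>src_filter V. ord.disjnt_elems c b" using src_in_src_filter[OF c(1)] by blast
  qed
qed

section \<open>Products of ultrafilters and the semigroupoid laws\<close>

lemma filter_pmult:
  assumes V: "ultra V" and W: "ultra W"
  shows "order_filter (proj_order P) (V \<cdot>\<^bsub>UB\<^esub> W)"
proof -
  obtain a b where "a \<in> V" "b \<in> W" using ord.ultrafilter_ex V W by meson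
  then show ?thesis
  proof (rule order_filterI[OF mult_in_pmult_UB])
    show "y \<in> V \<cdot>\<^bsub>UB\<^esub> W" if "x \<in> V \<cdot>\<^bsub>UB\<^esub> W" "x \<preceq> y" for x y
      using that prec_trans unfolding in_pmult_UB by blast
    fix x y assume "x \<in> V \<cdot>\<^bsub>UB\<^esub> W" "y \<in> V \<cdot>\<^bsub>UB\<^esub> W"
    then obtain v w v' w' where x: "v \<in> V" "w \<in> W" "v * w \<preceq> x"
      and y: "v' \<in> V" "w' \<in> W" "v' * w' \<preceq> y"
      unfolding in_pmult_UB by blast
    obtain r where r: "r \<in> V" "r \<preceq> v" "r \<preceq> v'" using ultra_lower_bound[OF V x(1) y(1)] .
    obtain t where t: "t \<in> W" "t \<preceq> w" "t \<preceq> w'" using ultra_lower_bound[OF W x(2) y(2)] .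
    have "r * t \<preceq> x" "r * t \<preceq> y"
      using prec_trans[OF mult_mono x(3)] prec_trans[OF mult_mono y(3)] r t by auto
    then show "\<exists>c\<in>V \<cdot>\<^bsub>UB\<^esub> W. c \<preceq> x \<and> c \<preceq> y" using mult_in_pmult_UB[OF r(1) t(1)] by blast
  qed
qed

lemma not_zero_pmult: "(V, W) \<in> composable UB \<Longrightarrow> z \<notin> V \<cdot>\<^bsub>UB\<^esub> W"
  using ord.le_zero unfolding composable_UB in_pmult_UB by blast

text \<open>An element \<open>b\<close> below \<open>v * w\<close> has the form
  \<open>v * (w * p)\<close> with \<open>p\<close> a projection, so it can be decided at
  \<open>w * p\<close> in \<open>W\<close>.\<close>

lemma ultra_pmult:
  assumes c: "(V, W) \<in> composable UB"
  shows "ultra (V \<cdot>\<^bsub>UB\<^esub> W)"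
proof -
  have V: "ultra V" and W: "ultra W" using c by (auto simp: composable_UB)
  obtain v w where v: "v \<in> V" and w: "w \<in> W" using ord.ultrafilter_ex V W by meson
  show ?thesis
  proof (rule ord.ultrafilterI[OF filter_pmult[OF V W] not_zero_pmult[OF c] mult_in_pmult_UB[OF v w]])
    fix b assume b: "b \<preceq> v * w" "b \<notin> V \<cdot>\<^bsub>UB\<^esub> W"
    \<comment> \<open>\<open>src b\<close> alone would also recover \<open>b\<close>, but
      \<open>disjnt_src\<close> asks for a projection below \<open>src w\<close>.\<close>
    define p where "p = src w * src b"
    have p: "p \<in> P" "src w * p = p" "w * p = w * src b"
      using proj_closed src_proj proj_idem mult_src unfolding p_def by (auto simp: mult.assoc[symmetric])
    have vwp: "v * (w * p) = b" using p(3) prec_src[OF b(1)] by (simp add: mult.assoc)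
    then have "w * p \<notin> W" using b(2) mult_in_pmult_UB[OF v] by metis
    then obtain c where c: "c \<in> W" "c \<preceq> w" "ord.disjnt_elems c (w * p)"
      using ultra_decides_below[OF W w] by blast
    have pc: "p * src c = z" using disjnt_src[OF p(1,2) c(2,3)] .
    have "ord.disjnt_elems (v * c) b"
      unfolding ord.disjnt_elems_def
    proof (intro ballI impI)
      \<comment> \<open>\<open>d\<close> is fixed on the right by both \<open>p\<close> and
        \<open>src c\<close>, whose product is \<open>z\<close>.\<close>
      fix d assume d: "d \<preceq> v * c" "d \<preceq> b"
      have "b * p = b" using vwp proj_idem[OF p(1)] by (metis mult.assoc)
      then have "d * p = d" using prec_mult_proj[OF d(2) p(1)] by blast
      moreover have "d * src c = d"
        using prec_mult_proj[OF d(1) src_proj] mult_src by (simp add: mult.assoc)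
      ultimately show "d = z" using pc mult_zero by (metis mult.assoc)
    qed
    then show "\<exists>c\<in>V \<cdot>\<^bsub>UB\<^esub> W. ord.disjnt_elems c b" using mult_in_pmult_UB[OF v c(1)] by blast
  qed
qed

lemma semigroupoid_UB: "semigroupoid UB"
proof
  show "composable UB \<subseteq> carrier UB \<times> carrier UB"
    using carrier_UB composable_UB by auto
  show "V \<cdot>\<^bsub>UB\<^esub> W \<in> carrier UB" if "(V, W) \<in> composable UB" for V W
    using ultra_pmult[OF that] carrier_UB by simp
next
  fix U V W assume "U \<in> carrier UB" "V \<in> carrier UB" "W \<in> carrier UB"
  then have UVW: "ultra U" "ultra V" "ultra W" by (simp_all add: carrier_UB)
  \<comment> \<open>Each bracketing is defined exactly when no triple product is
    \<open>z\<close>.\<close>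
  define nz where "nz \<longleftrightarrow> (\<forall>u\<in>U. \<forall>v\<in>V. \<forall>w\<in>W. u * v * w \<noteq> z)"
  have "(U, V) \<in> composable UB \<and> (U \<cdot>\<^bsub>UB\<^esub> V, W) \<in> composable UB \<longleftrightarrow> nz"
  proof
    assume "(U, V) \<in> composable UB \<and> (U \<cdot>\<^bsub>UB\<^esub> V, W) \<in> composable UB"
    then show nz using mult_in_pmult_UB by (auto simp: nz_def composable_UB)
  next
    assume nz
    obtain w where "w \<in> W" using ord.ultrafilter_ex UVW by blast
    then have uv: "(U, V) \<in> composable UB"
      using \<open>nz\<close> UVW zero_mult unfolding composable_UB nz_def by metis
    have "c * w \<noteq> z" if cw: "c \<in> U \<cdot>\<^bsub>UB\<^esub> V" "w \<in> W" for c w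
    proof -
      obtain u v where u: "u \<in> U" "v \<in> V" "u * v \<preceq> c" using cw(1) unfolding in_pmult_UB by blast
      have "u * v * w \<preceq> c * w" using u mult_mono prec_refl by blast
      then show ?thesis using ord.le_zero \<open>nz\<close> u cw(2) unfolding nz_def by metis
    qed
    then show "(U, V) \<in> composable UB \<and> (U \<cdot>\<^bsub>UB\<^esub> V, W) \<in> composable UB"
      using uv ultra_pmult[OF uv] UVW by (simp add: composable_UB)
  qed
  moreover have "(V, W) \<in> composable UB \<and> (U, V \<cdot>\<^bsub>UB\<^esub> W) \<in> composable UB \<longleftrightarrow> nz"
  proof
    assume "(V, W) \<in> composable UB \<and> (U, V \<cdot>\<^bsub>UB\<^esub> W) \<in> composable UB"
    then show nz using mult_in_pmult_UB by (auto simp: nz_def composable_UB mult.assoc)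
  next
    assume nz
    obtain u where "u \<in> U" using ord.ultrafilter_ex UVW by blast
    then have vw: "(V, W) \<in> composable UB"
      using \<open>nz\<close> UVW mult_zero unfolding composable_UB nz_def by (metis mult.assoc)
    have "u * c \<noteq> z" if cu: "c \<in> V \<cdot>\<^bsub>UB\<^esub> W" "u \<in> U" for c u
    proof -
      obtain v w where v: "v \<in> V" "w \<in> W" "v * w \<preceq> c" using cu(1) unfolding in_pmult_UB by blast
      have "u * v * w \<preceq> u * c" using mult_mono[OF prec_refl v(3)] by (simp add: mult.assoc)
      then show ?thesis using ord.le_zero \<open>nz\<close> v cu(2) unfolding nz_def by metis
    qed
    then show "(V, W) \<in> composable UB \<and> (U, V \<cdot>\<^bsub>UB\<^esub> W) \<in> composable UB"
      using vw ultra_pmult[OF vw] UVW by (simp add: composable_UB)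
  qed
  ultimately show "(U, V) \<in> composable UB \<and> (U \<cdot>\<^bsub>UB\<^esub> V, W) \<in> composable UB \<longleftrightarrow>
    (V, W) \<in> composable UB \<and> (U, V \<cdot>\<^bsub>UB\<^esub> W) \<in> composable UB" by simp
next
  fix U V W
  have "c \<in> U \<cdot>\<^bsub>UB\<^esub> V \<cdot>\<^bsub>UB\<^esub> W \<longleftrightarrow> (\<exists>u\<in>U. \<exists>v\<in>V. \<exists>w\<in>W. u * v * w \<preceq> c)" for c
    using mult_in_pmult_UB prec_trans[OF mult_mono[OF _ prec_refl]] in_pmult_UB by meson
  moreover have "c \<in> U \<cdot>\<^bsub>UB\<^esub> (V \<cdot>\<^bsub>UB\<^esub> W) \<longleftrightarrow> (\<exists>u\<in>U. \<exists>v\<in>V. \<exists>w\<in>W. u * v * w \<preceq> c)" for c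
    using mult_in_pmult_UB prec_trans[OF mult_mono[OF prec_refl]] in_pmult_UB
    unfolding mult.assoc by meson
  ultimately show "U \<cdot>\<^bsub>UB\<^esub> V \<cdot>\<^bsub>UB\<^esub> W = U \<cdot>\<^bsub>UB\<^esub> (V \<cdot>\<^bsub>UB\<^esub> W)" by blast
qed

text \<open>Multiplying by a projection only makes elements smaller, so the product contains
  \<open>A\<close>; being a proper filter, it equals \<open>A\<close> by maximality.\<close>

lemma punit_if_proj:
  assumes U: "ultra U" and p: "p \<in> U" "p \<in> P"
  shows "U \<in> punits UB"
  unfolding punits_def
proof (intro CollectI conjI ballI impI)
  show "U \<in> carrier UB" using U carrier_UB by simp
next
  fix A assume c: "(U, A) \<in> composable UB"
  then have A: "ultra A" by (simp add: composable_UB)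
  have "A \<subseteq> U \<cdot>\<^bsub>UB\<^esub> A" using p proj_mult_le in_pmult_UB by blast
  then show "U \<cdot>\<^bsub>UB\<^esub> A = A"
    using ord.ultrafilter_maximal[OF A] filter_pmult[OF U A] not_zero_pmult[OF c]
      ord.proper_filter_iff by blast
next
  fix A assume c: "(A, U) \<in> composable UB"
  then have A: "ultra A" by (simp add: composable_UB)
  have "A \<subseteq> A \<cdot>\<^bsub>UB\<^esub> U" using p mult_proj_prec in_pmult_UB by blast
  then show "A \<cdot>\<^bsub>UB\<^esub> U = A"
    using ord.ultrafilter_maximal[OF A] filter_pmult[OF A U] not_zero_pmult[OF c]
      ord.proper_filter_iff by blast
qed

lemma is_source_unit_src_filter:
  assumes V: "ultra V"
  shows "is_source_unit UB V (src_filter V)"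
proof -
  obtain a where "a \<in> V" using ord.ultrafilter_ex[OF V] by blast
  then have "src_filter V \<in> punits UB"
    using punit_if_proj[OF ultra_src_filter[OF V]] src_in_src_filter src_proj by blast
  moreover have "v * x \<noteq> z" if vx: "v \<in> V" "x \<in> src_filter V" for v x
  proof -
    obtain u where u: "u \<in> V" "src u \<preceq> x" using vx(2) by (auto simp: src_filter_def)
    obtain w where w: "w \<in> V" "w \<preceq> v" "w \<preceq> u" using ultra_lower_bound[OF V vx(1) u(1)] .
    have "w * src w \<preceq> v * x" using mult_mono prec_trans[OF src_mono u(2)] w by blast
    then show ?thesis using mult_src ord.le_zero ultra_not_zero[OF V w(1)] by metis
  qed
  ultimately show ?thesis
    using V ultra_src_filter[OF V] by (simp add: is_source_unit_def composable_UB)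
qed

text \<open>By \<open>mult_eq_zero_iff\<close>, whether products with \<open>W\<close> reach
  \<open>z\<close> depends on \<open>V\<close> only through its sources.\<close>

lemma composable_src_filter:
  assumes V: "ultra V" and W: "ultra W"
  shows "(src_filter V, W) \<in> composable UB \<longleftrightarrow> (V, W) \<in> composable UB"
proof -
  have "(\<forall>c\<in>src_filter V. \<forall>w\<in>W. c * w \<noteq> z) \<longleftrightarrow> (\<forall>v\<in>V. \<forall>w\<in>W. src v * w \<noteq> z)"
  proof (intro iffI ballI)
    fix c w assume *: "\<forall>v\<in>V. \<forall>w\<in>W. src v * w \<noteq> z" and c: "c \<in> src_filter V" and w: "w \<in> W"
    obtain v where v: "v \<in> V" "src v \<preceq> c" using c by (auto simp: src_filter_def)
    then have "src v * w \<preceq> c * w" using mult_mono prec_refl by blast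
    then show "c * w \<noteq> z" using * v w ord.le_zero by metis
  qed (use src_in_src_filter in blast)
  then show ?thesis
    using V W ultra_src_filter[OF V] mult_eq_zero_iff by (simp add: composable_UB)
qed

text \<open>\<open>V\<close> composes with \<open>W\<close> exactly when \<open>src_filter V\<close>
  is a range unit of \<open>W\<close>; uniqueness of source units identifies an arbitrary
  \<open>u\<close> with \<open>src_filter V\<close>.\<close>

lemma semicategory_UB: "semicategory UB"
proof -
  interpret semigroupoid UB by (rule semigroupoid_UB)
  show ?thesis
  proof
    show "\<exists>u. is_source_unit UB a u" if "a \<in> carrier UB" for a
      using that is_source_unit_src_filter carrier_UB by blast
  next
    fix V W assume "V \<in> carrier UB" "W \<in> carrier UB"
    then have VW: "ultra V" "ultra W" by (simp_all add: carrier_UB)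
    have s: "is_source_unit UB V (src_filter V)" using is_source_unit_src_filter VW by blast
    show "(V, W) \<in> composable UB \<longleftrightarrow> (\<exists>u. is_range_unit UB W u \<and> is_source_unit UB V u)"
    proof
      assume "(V, W) \<in> composable UB"
      then have "is_range_unit UB W (src_filter V)"
        using s composable_src_filter[OF VW] by (simp add: is_source_unit_def is_range_unit_def)
      then show "\<exists>u. is_range_unit UB W u \<and> is_source_unit UB V u" using s by blast
    next
      assume "\<exists>u. is_range_unit UB W u \<and> is_source_unit UB V u"
      then have "is_range_unit UB W (src_filter V)" using s source_unit_unique by blast
      then show "(V, W) \<in> composable UB"
        using composable_src_filter[OF VW] by (simp add: is_range_unit_def)
    qed
  qed
qed

text \<open>Converse to \<open>punit_if_proj\<close>: the product of the unit \<open>U\<close> with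
  its source unit equals both factors, so \<open>U\<close> is \<open>src_filter U\<close> and
  contains sources.\<close>

lemma punit_ex_proj:
  assumes U: "U \<in> punits UB"
  shows "\<exists>p\<in>U. p \<in> P"
proof -
  have u: "ultra U" using U carrier_UB by (simp add: punits_def)
  have s: "src_filter U \<in> punits UB" "(U, src_filter U) \<in> composable UB"
    using is_source_unit_src_filter[OF u] by (auto simp: is_source_unit_def)
  have "U \<cdot>\<^bsub>UB\<^esub> src_filter U = src_filter U" "U \<cdot>\<^bsub>UB\<^esub> src_filter U = U"
    using U s carrier_UB u ultra_src_filter[OF u] by (auto simp: punits_def)
  then have "src_filter U = U" by simp
  moreover obtain a where "a \<in> U" using ord.ultrafilter_ex[OF u] by blast
  ultimately show ?thesis using src_in_src_filter src_proj by metis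
qed

section \<open>Invertible elements and invertible ultrafilters\<close>

lemma invertible_in_ultrafilter:
  assumes inv: "pinverses UB V W"
  shows "invertibles P \<inter> V \<noteq> {}"
proof -
  interpret semicategory UB by (rule semicategory_UB)
  have c: "(V, W) \<in> composable UB" "(W, V) \<in> composable UB"
    and u: "V \<cdot>\<^bsub>UB\<^esub> W \<in> punits UB" "W \<cdot>\<^bsub>UB\<^esub> V \<in> punits UB"
    and VWV: "(V \<cdot>\<^bsub>UB\<^esub> W, V) \<in> composable UB"
    using inv by (auto simp: pinverses_def is_range_unit_def is_source_unit_def)
  have V: "ultra V" and W: "ultra W" using c by (auto simp: composable_UB)
  \<comment> \<open>A unit contains a projection \<open>p\<close>, and a product
    \<open>x * y\<close> below \<open>p\<close> is itself a projection.\<close>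
  have proj: "\<exists>x\<in>X. \<exists>y\<in>Y. x * y \<in> P" if unit: "X \<cdot>\<^bsub>UB\<^esub> Y \<in> punits UB" for X Y
  proof -
    obtain p where p: "p \<in> X \<cdot>\<^bsub>UB\<^esub> Y" "p \<in> P" using punit_ex_proj[OF unit] by blast
    then show ?thesis using prec_proj[OF p(2)] unfolding in_pmult_UB by blast
  qed
  obtain v w where vw: "v \<in> V" "w \<in> W" "v * w \<in> P" using proj[OF u(1)] by blast
  obtain v' w' where vw': "v' \<in> V" "w' \<in> W" "w' * v' \<in> P" using proj[OF u(2)] by blast
  \<comment> \<open>Lower bounds merge the two pairs into one pair \<open>r\<close>,
    \<open>t\<close> with both \<open>r * t\<close> and \<open>t * r\<close> projections.\<close>
  obtain r where r: "r \<in> V" "r \<preceq> v" "r \<preceq> v'" using ultra_lower_bound[OF V vw(1) vw'(1)] .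
  obtain t where t: "t \<in> W" "t \<preceq> w" "t \<preceq> w'" using ultra_lower_bound[OF W vw(2) vw'(2)] .
  define e f where "e = r * t" and "f = t * r"
  have e: "e \<in> P" and f: "f \<in> P"
    using prec_proj[OF vw(3) mult_mono] prec_proj[OF vw'(3) mult_mono] r t by (auto simp: e_def f_def)
  have ee: "e * e = e" and ff: "f * f = f" using e f proj_idem by auto
  have 1: "r * t * r * (t * r * t) = e" using ee unfolding e_def by (metis mult.assoc)
  have 2: "t * r * t * (r * t * r) = f" using ff unfolding f_def by (metis mult.assoc)
  \<comment> \<open>Nothing forces \<open>r * t * r = r\<close>, hence the longer words; their
    identities follow from idempotence of \<open>e\<close> and \<open>f\<close>.\<close>
  have "inverses P (r * t * r) (t * r * t)"
  proof (rule inversesI)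
    show "r * t * r * (t * r * t) \<in> P" "t * r * t * (r * t * r) \<in> P" using 1 2 e f by auto
    show "r * t * r * (t * r * t) * (r * t * r) = r * t * r"
      unfolding 1 using ee unfolding e_def by (metis mult.assoc)
    show "t * r * t * (r * t * r) * (t * r * t) = t * r * t"
      unfolding 2 using ff unfolding f_def by (metis mult.assoc)
  qed
  then have "r * t * r \<in> invertibles P" by (auto simp: invertibles_def)
  moreover have "V \<cdot>\<^bsub>UB\<^esub> W \<cdot>\<^bsub>UB\<^esub> V = V"
    using u(1) VWV V carrier_UB by (auto simp: punits_def)
  then have "r * t * r \<in> V" using mult_in_pmult_UB r t by metis
  ultimately show ?thesis by blast
qed

lemma ultrafilter_inverse:
  assumes V: "ultra V" and a: "a \<in> V" and ab: "inverses P a b"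
  shows "\<exists>W\<in>carrier UB. pinverses UB V W"
proof -
  interpret semicategory UB by (rule semicategory_UB)
  note inv = inversesD[OF ab]
  \<comment> \<open>For \<open>v\<close> below \<open>a\<close>, \<open>src v * b\<close> is the
    inverse of \<open>v\<close> built in \<open>invertibles_down\<close>; every member of
    \<open>V\<close> has such a \<open>v\<close> in \<open>V\<close> below it.\<close>
  define W where "W = {x. \<exists>v\<in>V. src v * b \<preceq> x}"
  have inW: "src v * b \<in> W" if "v \<in> V" for v
    using that prec_refl unfolding W_def by blast
  have bW: "b \<in> W" using inW[OF a] inv(4,5) by simp
  \<comment> \<open>The products of \<open>t\<close> with \<open>src t * b\<close> in either order;
    if one of them is \<open>z\<close>, then so is \<open>t\<close>.\<close>
  have nz: "src t * b * t = src t" "t * src t * b * a = t" if "t \<preceq> a" for t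
  proof -
    have "src t * b * t = src t * (b * a) * src t"
      using prec_src[OF that] by (metis mult.assoc)
    then show "src t * b * t = src t"
      using inv(2,5) src_mono[OF that] prec_mult_src proj_idem[OF src_proj[of t]]
        src_projection[OF inv(2)] by metis
    show "t * src t * b * a = t"
      using prec_mult_src[OF that] inv(5) mult_src by (metis mult.assoc)
  qed
  have f: "order_filter (proj_order P) W"
  proof (rule order_filterI[OF bW])
    show "y \<in> W" if "x \<in> W" "x \<preceq> y" for x y
      using that prec_trans unfolding W_def by blast
    fix x y assume "x \<in> W" "y \<in> W"
    then obtain u v where uv: "u \<in> V" "v \<in> V" "src u * b \<preceq> x" "src v * b \<preceq> y"
      by (auto simp: W_def)
    obtain w where w: "w \<in> V" "w \<preceq> u" "w \<preceq> v" using ultra_lower_bound[OF V uv(1,2)] .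
    have "src w * b \<preceq> x" "src w * b \<preceq> y"
      using w uv src_mono prec_trans mult_mono prec_refl by meson+
    then show "\<exists>c\<in>W. c \<preceq> x \<and> c \<preceq> y" using inW[OF w(1)] by blast
  qed
  have VW: "v * w \<noteq> z" and WV: "w * v \<noteq> z" if v: "v \<in> V" and w: "w \<in> W" for v w
  proof -
    obtain u where u: "u \<in> V" "src u * b \<preceq> w" using w by (auto simp: W_def)
    obtain r where r: "r \<in> V" "r \<preceq> v" "r \<preceq> u" using ultra_lower_bound[OF V v u(1)] .
    \<comment> \<open>With \<open>t\<close> below \<open>v\<close>, \<open>u\<close> and
      \<open>a\<close>, the products \<open>v * w\<close> and \<open>w * v\<close> dominate those
      treated in \<open>nz\<close>.\<close>
    obtain t where t: "t \<in> V" "t \<preceq> r" "t \<preceq> a" using ultra_lower_bound[OF V r(1) a] .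
    have tv: "t \<preceq> v" and tu: "t \<preceq> u" using prec_trans r t by blast+
    have tw: "src t * b \<preceq> w" using prec_trans[OF mult_mono[OF src_mono[OF tu] prec_refl] u(2)] .
    have tz: "t \<noteq> z" using ultra_not_zero[OF V t(1)] .
    have "t * (src t * b) \<preceq> v * w" using mult_mono tv tw by blast
    then show "v * w \<noteq> z" using nz(2)[OF t(3)] tz ord.le_zero zero_mult by (metis mult.assoc)
    have "src t * b * t \<preceq> w * v" using mult_mono tv tw by blast
    then show "w * v \<noteq> z" using nz(1)[OF t(3)] tz ord.le_zero src_eq_zero by metis
  qed
  have "z \<notin> W" using WV[OF a] zero_mult by blast
  then have W: "ultra W"
  proof (rule ord.ultrafilterI[OF f _ bW])
    fix x assume x: "x \<preceq> b" "x \<notin> W"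
    \<comment> \<open>Elements \<open>x\<close> below \<open>b\<close> correspond to projections
      \<open>p\<close> below \<open>src a\<close> through \<open>x = p * b\<close>, so
      \<open>x\<close> can be decided at \<open>a * p\<close> in \<open>V\<close>.\<close>
    define p where "p = x * a"
    have p: "p \<in> P" using prec_proj[OF inv(2) mult_mono[OF x(1) prec_refl]] by (simp add: p_def)
    have pb: "p * b = x"
      using prec_mult_src[OF x(1)] inv(6) by (simp add: p_def mult.assoc)
    have sap: "src a * p = p"
      using prec_fixed[OF x(1) inv(4)] inv(5) by (simp add: p_def mult.assoc[symmetric])
    have "a * p \<notin> V"
      using x(2) inW[of "a * p"] src_mult_proj[OF p, of a] sap pb by auto
    then obtain c where c: "c \<in> V" "c \<preceq> a" "ord.disjnt_elems c (a * p)"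
      using ultra_decides_below[OF V a] by blast
    have pc: "p * src c = z" using disjnt_src[OF p sap c(2,3)] .
    have "ord.disjnt_elems (src c * b) x"
      unfolding ord.disjnt_elems_def
    proof (intro ballI impI)
      fix d assume d: "d \<preceq> src c * b" "d \<preceq> x"
      have "src c * d = d"
        using prec_fixed[OF d(1)] proj_idem[OF src_proj] by (simp add: mult.assoc[symmetric])
      moreover have "p * d = d"
        using prec_fixed[OF d(2)] proj_idem[OF p] pb by (metis mult.assoc)
      ultimately show "d = z" using pc zero_mult by (metis mult.assoc)
    qed
    then show "\<exists>c\<in>W. ord.disjnt_elems c x" using inW[OF c(1)] by blast
  qed
  have c: "(V, W) \<in> composable UB" "(W, V) \<in> composable UB"
    using V W VW WV by (auto simp: composable_UB)
  \<comment> \<open>The products contain the projections \<open>a * b\<close> and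
    \<open>b * a\<close>, hence are units.\<close>
  have "V \<cdot>\<^bsub>UB\<^esub> W \<in> punits UB" "W \<cdot>\<^bsub>UB\<^esub> V \<in> punits UB"
    using punit_if_proj ultra_pmult c mult_in_pmult_UB a bW inv(1,2) by blast+
  then have "pinverses UB V W" using pinversesI c by blast
  then show ?thesis using W carrier_UB by blast
qed

lemma groupoid_UB_iff:
  "groupoid UB \<longleftrightarrow> (\<forall>V. ultra V \<longrightarrow> invertibles P \<inter> V \<noteq> {})"
proof
  assume "groupoid UB"
  then show "\<forall>V. ultra V \<longrightarrow> invertibles P \<inter> V \<noteq> {}"
    using groupoid.inverse_exists invertible_in_ultrafilter carrier_UB by metis
next
  assume *: "\<forall>V. ultra V \<longrightarrow> invertibles P \<inter> V \<noteq> {}"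
  interpret semicategory UB by (rule semicategory_UB)
  show "groupoid UB"
  proof
    fix V assume "V \<in> carrier UB"
    then have V: "ultra V" by (simp add: carrier_UB)
    then obtain a b where "a \<in> V" "inverses P a b"
      using * unfolding invertibles_def by blast
    then show "\<exists>W\<in>carrier UB. pinverses UB V W" using ultrafilter_inverse[OF V] by blast
  qed
qed

end

theorem proposition6p8:
  fixes P :: "'a::semigroup_mult set" and z :: 'a
  assumes "semi_boolean_restriction_semigroup P z"
  shows "groupoid (ultrafilter_semicategory P z) \<longleftrightarrow>
    (\<forall>a. \<exists>F. finite F \<and> F \<subseteq> invertibles P \<and> is_lub (proj_order P) a F)"
proof -
  interpret semi_boolean_restriction_semigroup P z by (rule assms)
  show ?thesis
    unfolding groupoid_UB_iff
  proof (intro iffI allI impI)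
    fix a assume "\<forall>V. ultra V \<longrightarrow> invertibles P \<inter> V \<noteq> {}"
    then show "\<exists>F. finite F \<and> F \<subseteq> invertibles P \<and> is_lub (proj_order P) a F"
      using ord.finite_join_if_ultrafilters_meet[of "invertibles P" a] invertibles_down by blast
  next
    fix V assume joins: "\<forall>a. \<exists>F. finite F \<and> F \<subseteq> invertibles P \<and> is_lub (proj_order P) a F"
      and V: "ultra V"
    obtain v where v: "v \<in> V" using ord.ultrafilter_ex[OF V] by blast
    obtain F where F: "finite F" "F \<subseteq> invertibles P" "is_lub (proj_order P) v F"
      using joins by blast
    then have "F \<inter> V \<noteq> {}" using ord.ultrafilter_finite_prime[OF V v] by blast
    then show "invertibles P \<inter> V \<noteq> {}" using F(2) by blast
  qed
qed

end
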